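(* Let $m>1$ be an integer and let $p$ be a prime with $p\nmid (m-1)$. Let $r\geq 1$ and let $f:\mathbb{Z}/p^r\mathbb{Z}\to\mathbb{Z}/p^r\mathbb{Z}$ be a bijection. Then either $$f(f(f(f(x))))\neq x$$ for at least $p^r/2$ values of $x\in\mathbb{Z}/p^r\mathbb{Z}$, or $$f(x+1)\neq m f(x)$$ for at least $p^{r/4-1}/2^{1/4}$ values of $x\in\mathbb{Z}/p^r\mathbb{Z}$.
   Context: The quantity $p^{r/4-1}/2^{1/4}$ is a real number (with real exponent $r/4-1$). The "or" is inclusive. *)

theory Defs
  imports Complex_Main "HOL-Number_Theory.Residues"
begin

end

theory Submission
  imports Defs
begin

text \<open>
  The idea is that \<open>f\<close> is exponential, \<open>f (s + d) = m ^ d * f s\<close>, along each of the arcs into which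
  the places with \<open>f (x + 1) \<noteq> m * f x\<close> cut the cycle \<open>\<int>/p\<^sup>r\<close>. If \<open>d\<close> is known modulo \<open>p - 1\<close> and
  modulo \<open>p ^ k\<close>, then Euler's theorem determines \<open>m ^ d\<close> modulo \<open>p ^ (k + 1)\<close>. So once the arcs
  and the offsets modulo \<open>p - 1\<close> of the four points of a cycle \<open>x, f x, f\<^sup>2 x, f\<^sup>3 x\<close> are fixed, going
  round the cycle gains one \<open>p\<close>-adic digit per step, and \<open>x\<close> is determined. With \<open>c\<close> arcs there are
  thus at most \<open>(c * (p - 1)) ^ 4\<close> solutions of \<open>f\<^sup>4 x = x\<close>.
\<close>

section \<open>Powers modulo prime powers, exponential arcs and four-cycles\<close>

lemma (in residues) add_pow_nat_eq: "[n] \<cdot> x = (int n * x) mod m"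
  by (induction n)
    (simp_all add: res_zero_eq res_add_eq add.nat_pow_0 add.nat_pow_Suc mod_simps algebra_simps)

text \<open>The coprime factors \<open>p ^ k\<close> and \<open>p - 1\<close> multiply to
  \<open>totient (p ^ Suc k)\<close>, so Euler's theorem applies. The extra digit in the modulus
  drives the whole counting argument.\<close>

lemma power_cong_prime_power:
  fixes m p k d e :: nat
  assumes "prime p" "coprime m p" "[d = e] (mod p ^ k)" "[d = e] (mod (p - 1))"
  shows "[m ^ d = m ^ e] (mod p ^ Suc k)"
  using assms(3,4)
proof (induction d e rule: linorder_wlog)
  case (le d e)
  have "p ^ k dvd e - d" "p - 1 dvd e - d"
    using le cong_altdef_nat[of d e] by (simp_all add: cong_sym_eq)
  moreover have "coprime (p ^ k) (p - 1)"
    using coprime_diff_one_right_nat[OF prime_gt_0_nat[OF assms(1)]] by simp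
  ultimately have "totient (p ^ Suc k) dvd e - d"
    unfolding totient_prime_power_Suc[OF assms(1)] by (rule divides_mult)
  then obtain q where q: "e - d = totient (p ^ Suc k) * q" by blast
  have "[m ^ totient (p ^ Suc k) = 1] (mod p ^ Suc k)"
    using assms(2) by (intro euler_theorem) simp
  from cong_pow[OF this, of q] have "[m ^ (e - d) = 1] (mod p ^ Suc k)"
    by (simp add: q power_mult)
  from cong_scalar_left[OF this, of "m ^ d"] show ?case
    using le(1) by (simp add: cong_sym_eq flip: power_add)
qed (simp add: cong_sym_eq)

text \<open>Every \<open>x\<close> lies on an arc that begins just after some \<open>y\<close> in
  \<open>F\<close>. The proof walks forward from a fixed element of \<open>F\<close> and restarts
  the arc whenever it meets \<open>F\<close>.\<close>

lemma ex_exponential_arc: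
  fixes f :: "int \<Rightarrow> int" and N :: int and m :: nat
  assumes "N > 0"
    and F: "F = {x \<in> {0..<N}. f ((x + 1) mod N) \<noteq> (int m * f x) mod N}" "F \<noteq> {}"
    and "x \<in> {0..<N}"
  shows "\<exists>y\<in>F. \<exists>d::nat. [x = y + 1 + int d] (mod N) \<and> [f x = int m ^ d * f ((y + 1) mod N)] (mod N)"
proof -
  from F(2) obtain y0 where y0: "y0 \<in> F" by blast
  have *: "\<exists>y\<in>F. \<exists>d::nat. [y0 + 1 + int n = y + 1 + int d] (mod N) \<and>
           [f ((y0 + 1 + int n) mod N) = int m ^ d * f ((y + 1) mod N)] (mod N)" for n
  proof (induction n)
    case 0
    show ?case using y0 by (intro bexI[of _ y0] exI[of _ 0]) auto
  next
    case (Suc n)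
    define z where "z = (y0 + 1 + int n) mod N"
    have z: "z \<in> {0..<N}" using \<open>N > 0\<close> by (simp add: z_def)
    have z1: "(y0 + 1 + int (Suc n)) mod N = (z + 1) mod N"
      by (simp add: z_def mod_simps algebra_simps)
    show ?case
    proof (cases "z \<in> F")
      case True
      \<comment> \<open>The step out of \<open>z\<close> breaks the rule, so a new arc starts at
        \<open>z + 1\<close> with offset 0.\<close>
      with z1 show ?thesis
        by (intro bexI[of _ z] exI[of _ 0]) (auto simp: cong_def)
    next
      case False
      from Suc.IH obtain y d where y: "y \<in> F" and d: "[z = y + 1 + int d] (mod N)"
        "[f z = int m ^ d * f ((y + 1) mod N)] (mod N)"
        by (auto simp: z_def)
      have "[f ((z + 1) mod N) = int m * f z] (mod N)"
        using False z by (simp add: F(1) cong_def)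
      also have "[int m * f z = int m * (int m ^ d * f ((y + 1) mod N))] (mod N)"
        by (intro cong_scalar_left d)
      finally have "[f ((z + 1) mod N) = int m ^ Suc d * f ((y + 1) mod N)] (mod N)"
        by (simp add: mult.assoc)
      moreover have "[y0 + 1 + int (Suc n) = y + 1 + int (Suc d)] (mod N)"
        using cong_add[OF d(1) cong_refl[of 1]] z1 by (simp add: cong_def algebra_simps)
      ultimately show ?thesis using y z1 by metis
    qed
  qed
  define n where "n = nat ((x - y0 - 1) mod N)"
  have "(y0 + 1 + int n) mod N = x"
    using assms(1,4) by (simp add: n_def mod_simps)
  with *[of n] show ?thesis
    using assms(4) by (auto simp: cong_def)
qed

text \<open>Induction on \<open>k\<close>: all four points agree modulo \<open>p ^ k\<close>,
  trivially for \<open>k = 0\<close>. By \<open>lift\<close> their images agree modulo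
  \<open>p ^ Suc k\<close>, and since the cycle closes these images are the same four points. At
  \<open>k = r\<close> they coincide.\<close>

lemma inj_on_cycle_labels:
  fixes f :: "int \<Rightarrow> int" and p :: int
  assumes fC: "f ` {0..<p ^ r} \<subseteq> {0..<p ^ r}"
    and lift: "\<And>x y k. x \<in> {0..<p ^ r} \<Longrightarrow> y \<in> {0..<p ^ r} \<Longrightarrow> k < r \<Longrightarrow> L x = L y \<Longrightarrow>
          [x = y] (mod p ^ k) \<Longrightarrow> [f x = f y] (mod p ^ Suc k)"
  shows "inj_on (\<lambda>x. (L x, L (f x), L (f (f x)), L (f (f (f x)))))
           {x \<in> {0..<p ^ r}. f (f (f (f x))) = x}"
proof (rule inj_onI, clarify)
  fix x y
  assume C: "x \<in> {0..<p ^ r}" "y \<in> {0..<p ^ r}"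
    and cyc: "f (f (f (f x))) = x" "f (f (f (f y))) = y"
    and L: "L x = L y" "L (f x) = L (f y)" "L (f (f x)) = L (f (f y))"
      "L (f (f (f x))) = L (f (f (f y)))"
  have fin: "f z \<in> {0..<p ^ r}" if "z \<in> {0..<p ^ r}" for z
    using that fC by blast
  have "k \<le> r \<Longrightarrow> [x = y] (mod p ^ k) \<and> [f x = f y] (mod p ^ k) \<and>
     [f (f x) = f (f y)] (mod p ^ k) \<and> [f (f (f x)) = f (f (f y))] (mod p ^ k)" for k
  proof (induction k)
    case (Suc k)
    then have k: "k < r" by simp
    show ?case
      using Suc lift[OF _ _ k L(1)] lift[OF _ _ k L(2)] lift[OF _ _ k L(3)] lift[OF _ _ k L(4)]
        C fin cyc by (metis Suc_leD)
  qed auto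
  from this[of r] show "x = y"
    using C by (auto simp: cong_def)
qed

lemma card_four_cycles_le:
  fixes f :: "int \<Rightarrow> int" and m p r :: nat
  defines "N \<equiv> int p ^ r"
  assumes "prime p" "coprime m p" and fC: "f ` {0..<N} \<subseteq> {0..<N}"
    and F: "F = {x \<in> {0..<N}. f ((x + 1) mod N) \<noteq> (int m * f x) mod N}" "F \<noteq> {}"
  shows "card {x \<in> {0..<N}. f (f (f (f x))) = x} \<le> (card F * (p - 1)) ^ 4"
proof -
  have "p > 1" using assms(2) by (rule prime_gt_1_nat)
  then have "N > 0" by (simp add: N_def)
  have "\<exists>y d. x \<in> {0..<N} \<longrightarrow> y \<in> F \<and> [x = y + 1 + int d] (mod N) \<and>
          [f x = int m ^ d * f ((y + 1) mod N)] (mod N)" for x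
    using ex_exponential_arc[OF \<open>N > 0\<close> F, of x] by blast
  then obtain s d where sd: "\<And>x. x \<in> {0..<N} \<Longrightarrow> s x \<in> F"
    "\<And>x. x \<in> {0..<N} \<Longrightarrow> [x = s x + 1 + int (d x)] (mod N)"
    "\<And>x. x \<in> {0..<N} \<Longrightarrow> [f x = int m ^ d x * f ((s x + 1) mod N)] (mod N)"
    by metis
  \<comment> \<open>The residue of the offset modulo \<open>p ^ k\<close> need not be stored: it
    follows from \<open>s x\<close> and \<open>x\<close> modulo \<open>p ^ k\<close>.\<close>
  define L where "L x = (s x, d x mod (p - 1))" for x
  have lift: "[f x = f y] (mod int p ^ Suc k)"
    if C: "x \<in> {0..<N}" "y \<in> {0..<N}" and "k < r" and L: "L x = L y"
      and xy: "[x = y] (mod int p ^ k)" for x y k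
  proof -
    from L have s: "s x = s y" and dp: "[d x = d y] (mod (p - 1))"
      by (simp_all add: L_def cong_def)
    have dvd: "int p ^ k dvd N" "int p ^ Suc k dvd N"
      using \<open>k < r\<close> unfolding N_def by (auto intro!: le_imp_power_dvd simp del: power_Suc)
    have "[s x + 1 + int (d x) = x] (mod int p ^ k)"
      using cong_dvd_modulus[OF sd(2)[OF C(1)] dvd(1)] by (rule cong_sym)
    also note xy
    also have "[y = s x + 1 + int (d y)] (mod int p ^ k)"
      using cong_dvd_modulus[OF sd(2)[OF C(2)] dvd(1)] s by simp
    finally have "[int (d x) = int (d y)] (mod int (p ^ k))"
      by (simp add: cong_add_lcancel)
    then have "[d x = d y] (mod p ^ k)" by (simp only: cong_int_iff)
    from power_cong_prime_power[OF assms(2,3) this dp]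
    have "[int (m ^ d x) = int (m ^ d y)] (mod int (p ^ Suc k))" by (simp only: cong_int_iff)
    then have m: "[int m ^ d x = int m ^ d y] (mod int p ^ Suc k)" by simp
    have "[f x = int m ^ d x * f ((s x + 1) mod N)] (mod int p ^ Suc k)"
      by (rule cong_dvd_modulus[OF sd(3)[OF C(1)] dvd(2)])
    also have "[int m ^ d x * f ((s x + 1) mod N) = int m ^ d y * f ((s x + 1) mod N)]
        (mod int p ^ Suc k)"
      by (rule cong_scalar_right[OF m])
    also have "[int m ^ d y * f ((s x + 1) mod N) = f y] (mod int p ^ Suc k)"
      unfolding s by (rule cong_sym[OF cong_dvd_modulus[OF sd(3)[OF C(2)] dvd(2)]])
    finally show ?thesis .
  qed
  have "finite F" unfolding F(1) by (rule finite_subset[of _ "{0..<N}"]) auto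
  define A where "A = F \<times> {0..<p - 1}"
  have A: "finite A" "card A = card F * (p - 1)"
    using \<open>finite F\<close> by (auto simp: A_def)
  have LA: "L x \<in> A" if "x \<in> {0..<N}" for x
    using that sd(1) \<open>p > 1\<close> by (auto simp: L_def A_def)
  have fin: "f z \<in> {0..<N}" if "z \<in> {0..<N}" for z
    using that fC by blast
  have "card {x \<in> {0..<N}. f (f (f (f x))) = x} \<le> card (A \<times> A \<times> A \<times> A)"
  proof (rule card_inj_on_le)
    show "inj_on (\<lambda>x. (L x, L (f x), L (f (f x)), L (f (f (f x)))))
           {x \<in> {0..<N}. f (f (f (f x))) = x}"
      using fC lift unfolding N_def by (rule inj_on_cycle_labels)
    show "(\<lambda>x. (L x, L (f x), L (f (f x)), L (f (f (f x))))) `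
        {x \<in> {0..<N}. f (f (f (f x))) = x} \<subseteq> A \<times> A \<times> A \<times> A"
      using LA fin by auto
  qed (use A in auto)
  also have "\<dots> = (card F * (p - 1)) ^ 4"
    by (simp only: A(2) card_cartesian_product power4_eq_xxxx mult.assoc)
  finally show ?thesis .
qed

text \<open>Otherwise \<open>f\<close> is globally exponential, and one turn round the cycle gives
  \<open>m ^ (p ^ r) * f 0 = f 0\<close> modulo \<open>N\<close>. Cancelling \<open>f 0\<close>
  modulo \<open>p\<close> and applying Fermat repeatedly yields \<open>m = 1\<close> modulo
  \<open>p\<close>.\<close>

lemma ex_non_exponential:
  fixes f :: "int \<Rightarrow> int" and m p r :: nat
  defines "N \<equiv> int p ^ r"
  assumes "prime p" "r \<ge> 1" "\<not> int p dvd int m - 1" and bij: "bij_betw f {0..<N} {0..<N}"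
  shows "\<exists>x\<in>{0..<N}. f ((x + 1) mod N) \<noteq> (int m * f x) mod N"
proof (rule ccontr)
  assume "\<not> ?thesis"
  then have step: "f ((x + 1) mod N) = (int m * f x) mod N" if "x \<in> {0..<N}" for x
    using that by blast
  have "p > 1" using assms(2) by (rule prime_gt_1_nat)
  then have "N > 1" using \<open>r \<ge> 1\<close> by (simp add: N_def)
  have pN: "int p dvd N" using \<open>r \<ge> 1\<close> by (simp add: N_def dvd_power)
  have pow: "[f (int n mod N) = int m ^ n * f 0] (mod N)" for n
  proof (induction n)
    case (Suc n)
    have "f (int (Suc n) mod N) = (int m * f (int n mod N)) mod N"
      using step[of "int n mod N"] \<open>N > 1\<close> by (simp add: mod_simps algebra_simps)
    then have "[f (int (Suc n) mod N) = int m * f (int n mod N)] (mod N)" by simp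
    also have "[int m * f (int n mod N) = int m * (int m ^ n * f 0)] (mod N)"
      by (rule cong_scalar_left[OF Suc.IH])
    finally show ?case by (simp add: mult.assoc)
  qed simp
  \<comment> \<open>Attaining the value 1 makes \<open>f 0\<close> a unit modulo
    \<open>p\<close>.\<close>
  have "1 \<in> f ` {0..<N}" using bij \<open>N > 1\<close> by (simp add: bij_betw_def)
  then obtain x where x: "x \<in> {0..<N}" "f x = 1" by force
  with pow[of "nat x"] have "[1 = int m ^ nat x * f 0] (mod N)" by simp
  then have one: "[1 = int m ^ nat x * f 0] (mod int p)" by (rule cong_dvd_modulus[OF _ pN])
  have pp: "prime (int p)" using assms(2) by simp
  have f0: "\<not> int p dvd f 0"
    using cong_dvd_iff[OF one] pp by (auto simp: prime_int_iff zdvd1_eq)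
  have "[f 0 = int m ^ p ^ r * f 0] (mod N)"
    using pow[of "p ^ r"] by (simp add: N_def)
  then have "[1 * f 0 = int m ^ p ^ r * f 0] (mod int p)"
    by (simp add: cong_dvd_modulus[OF _ pN])
  then have "[1 = int m ^ p ^ r] (mod int p)"
    using prime_imp_coprime[OF pp f0] by (subst (asm) cong_mult_rcancel) (simp_all add: coprime_commute)
  also have "[int m ^ p ^ r = int m] (mod int p)"
  proof (induction r)
    case (Suc r)
    have "[(int m ^ p ^ r) ^ p = int m ^ p] (mod int p)" by (rule cong_pow[OF Suc.IH])
    also have "[int m ^ p = int m] (mod int p)"
    proof (cases "p dvd m")
      case True
      then have "[int m ^ p = 0] (mod int p)" "[int m = 0] (mod int p)"
        using \<open>p > 1\<close> by (auto simp: cong_0_iff intro: dvd_trans[OF _ dvd_power])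
      then show ?thesis by (metis cong_sym cong_trans)
    next
      case False
      have "[int (m ^ (p - 1)) = int 1] (mod int p)"
        using fermat_theorem[OF assms(2) False] by (simp only: cong_int_iff)
      from cong_scalar_left[OF this, of "int m"] show ?thesis
        using \<open>p > 1\<close> by (simp flip: power_Suc)
    qed
    finally show ?case by (simp add: mult.commute flip: power_mult)
  qed simp
  finally have "int p dvd int m - 1"
    by (metis cong_iff_dvd_diff cong_sym)
  with assms(4) show False ..
qed

section \<open>Counting when \<open>p\<close> divides \<open>m\<close>, and estimates for the
  threshold\<close>

lemma card_eq_card_filter_add_card_filter_not:
  assumes "finite A"
  shows "card A = card {x \<in> A. P x} + card {x \<in> A. \<not> P x}"
proof -
  have "A = {x \<in> A. P x} \<union> {x \<in> A. \<not> P x}" by blast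
  also have "card \<dots> = card {x \<in> A. P x} + card {x \<in> A. \<not> P x}"
    using assms by (intro card_Un_disjoint) auto
  finally show ?thesis .
qed

lemma card_nonmultiples_prime_power:
  fixes p r :: nat
  assumes "prime p" "r \<ge> 1"
  shows "2 * card {x \<in> {0..<int p ^ r}. \<not> int p dvd x} \<ge> p ^ r"
proof -
  have "p \<ge> 2" using assms(1) by (rule prime_ge_2_nat)
  obtain q where r: "r = Suc q" using assms(2) by (cases r) auto
  have eq: "{x \<in> {0..<int p ^ r}. int p dvd x} = (\<lambda>x. int p * x) ` {0..<int p ^ q}"
    using \<open>p \<ge> 2\<close> by (auto simp: r elim!: dvdE simp: zero_le_mult_iff)
  have "card {x \<in> {0..<int p ^ r}. int p dvd x} = p ^ q"
    unfolding eq using \<open>p \<ge> 2\<close> by (subst card_image) (auto simp: inj_on_def nat_power_eq)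
  moreover have "card {0..<int p ^ r} = card {x \<in> {0..<int p ^ r}. int p dvd x} +
      card {x \<in> {0..<int p ^ r}. \<not> int p dvd x}"
    by (rule card_eq_card_filter_add_card_filter_not) simp
  ultimately have "p ^ r = p ^ q + card {x \<in> {0..<int p ^ r}. \<not> int p dvd x}"
    by (simp add: nat_power_eq)
  moreover have "2 * p ^ q \<le> p ^ r" using \<open>p \<ge> 2\<close> by (simp add: r)
  ultimately show ?thesis by linarith
qed

text \<open>If \<open>p\<close> divides \<open>m\<close>, then \<open>f (x + 1) = m * f x\<close> forces \<open>p\<close> to divide \<open>f (x + 1)\<close>.\<close>

lemma card_non_exponential_ge:
  fixes f :: "int \<Rightarrow> int" and m p r :: nat
  defines "N \<equiv> int p ^ r"
  assumes "prime p" "r \<ge> 1" "p dvd m" and bij: "bij_betw f {0..<N} {0..<N}"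
  shows "2 * card {x \<in> {0..<N}. f ((x + 1) mod N) \<noteq> (int m * f x) mod N} \<ge> p ^ r"
proof -
  have "N > 0" using prime_gt_0_nat[OF assms(2)] by (simp add: N_def)
  have pN: "int p dvd N" using \<open>r \<ge> 1\<close> by (simp add: N_def dvd_power)
  define F where "F = {x \<in> {0..<N}. f ((x + 1) mod N) \<noteq> (int m * f x) mod N}"
  \<comment> \<open>Each nonmultiple of \<open>p\<close> is a value of \<open>f\<close> at some
    \<open>x + 1\<close>, and such an \<open>x\<close> must be exceptional.\<close>
  have "{x \<in> {0..<N}. \<not> int p dvd x} \<subseteq> (\<lambda>x. f ((x + 1) mod N)) ` F"
  proof clarify
    fix y assume y: "y \<in> {0..<N}" "\<not> int p dvd y"
    then obtain z where z: "z \<in> {0..<N}" "y = f z" using bij by (metis bij_betw_imp_surj_on imageE)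
    define x where "x = (z - 1) mod N"
    have x: "x \<in> {0..<N}" "(x + 1) mod N = z"
      using \<open>N > 0\<close> z by (auto simp: x_def mod_simps)
    moreover have "int p dvd (int m * f x) mod N"
      using assms(4) pN by (simp add: dvd_mod_iff)
    ultimately show "y \<in> (\<lambda>x. f ((x + 1) mod N)) ` F"
      using y z by (auto simp: F_def intro!: image_eqI[of _ _ x])
  qed
  moreover have "finite F" unfolding F_def by (rule finite_subset[of _ "{0..<N}"]) auto
  ultimately have "card {x \<in> {0..<N}. \<not> int p dvd x} \<le> card F"
    by (meson surj_card_le)
  with card_nonmultiples_prime_power[OF assms(2,3)] show ?thesis
    by (simp add: F_def N_def)
qed

text \<open>A crude comparison, from \<open>r / 4 - 1 \<le> r - 1\<close>: it shows that half of all
  residues already reach the threshold, which settles the case of \<open>p\<close> dividing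
  \<open>m\<close>.\<close>

lemma powr_quarter_le_half_power:
  fixes p r :: nat
  assumes "p \<ge> 2"
  shows "real p powr (real r / 4 - 1) / 2 powr (1 / 4) \<le> real p ^ r / 2"
proof -
  have "real p powr (real r / 4 - 1) \<le> real p powr (real r - 1)"
    using assms by (intro powr_mono) auto
  also have "\<dots> = real p ^ r / real p"
    using assms by (simp add: powr_diff powr_realpow)
  also have "\<dots> \<le> real p ^ r / 2"
    using assms by (intro divide_left_mono) auto
  finally have "real p powr (real r / 4 - 1) \<le> real p ^ r / 2" .
  moreover have "real p powr (real r / 4 - 1) / 2 powr (1 / 4) \<le> real p powr (real r / 4 - 1) / 1"
    by (intro divide_left_mono) (auto simp: ge_one_powr_ge_zero)
  ultimately show ?thesis by linarith
qed

text \<open>The fourth power of the threshold is \<open>p powr (r - 4) / 2\<close>. The missing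
  \<open>p ^ 4\<close> absorbs the \<open>(p - 1) ^ 4\<close> from the label count, and the
  \<open>2 powr (1 / 4)\<close> yields the factor 2.\<close>

lemma power4_less_of_less_powr_quarter:
  fixes p r k :: nat
  assumes "p \<ge> 2" "real k < real p powr (real r / 4 - 1) / 2 powr (1 / 4)"
  shows "2 * real (k * (p - 1)) ^ 4 \<le> real p ^ r"
proof -
  have "real k ^ 4 \<le> (real p powr (real r / 4 - 1) / 2 powr (1 / 4)) ^ 4"
    using assms by (intro power_mono) auto
  also have "\<dots> = real p powr (real r - 4) / 2"
    using assms by (simp add: power_divide powr_power algebra_simps)
  also have "\<dots> = real p ^ r / real p ^ 4 / 2"
    using assms by (simp add: powr_diff powr_realpow)
  finally have "2 * (real k ^ 4 * real p ^ 4) \<le> real p ^ r"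
    using assms by (simp add: field_simps)
  moreover have "real (p - 1) ^ 4 \<le> real p ^ 4" by (intro power_mono) auto
  then have "real k ^ 4 * real (p - 1) ^ 4 \<le> real k ^ 4 * real p ^ 4"
    by (intro mult_left_mono) auto
  ultimately show ?thesis by (simp add: power_mult_distrib)
qed

theorem proposition3:
  fixes m :: int and p r :: nat and f :: "int \<Rightarrow> int" and R (structure)
  defines "R \<equiv> residue_ring (int p ^ r)"
  assumes "m > 1"
    and "prime p"
    and "\<not> int p dvd (m - 1)"
    and "r \<ge> 1"
    and "bij_betw f (carrier R) (carrier R)"
  shows "real (card {x \<in> carrier R. f (f (f (f x))) \<noteq> x}) \<ge> real p ^ r / 2
       \<or> real (card {x \<in> carrier R. f (x \<oplus> \<one>) \<noteq> [m] \<cdot> f x})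
           \<ge> real p powr (real r / 4 - 1) / 2 powr (1 / 4)"
proof -
  define N where "N = int p ^ r"
  have "p \<ge> 2" using \<open>prime p\<close> by (rule prime_ge_2_nat)
  then have "N > 1" using \<open>r \<ge> 1\<close> by (simp add: N_def)
  then interpret residues N R
    by unfold_locales (simp_all add: R_def N_def)
  obtain n where m: "m = int n" using \<open>m > 1\<close> zero_le_imp_eq_int[of m] by auto
  have C: "carrier R = {0..<N}" by (auto simp: res_carrier_eq)
  have mult: "[m] \<cdot> x = (int n * x) mod N" for x
    using add_pow_nat_eq[of n x] by (simp add: m add_pow_int_ge)
  define F where "F = {x \<in> {0..<N}. f ((x + 1) mod N) \<noteq> (int n * f x) mod N}"
  define G where "G = {x \<in> {0..<N}. f (f (f (f x))) = x}"
  have F: "{x \<in> carrier R. f (x \<oplus> \<one>) \<noteq> [m] \<cdot> f x} = F"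
    by (simp add: F_def C mult res_add_eq res_one_eq)
  have bij: "bij_betw f {0..<N} {0..<N}" using assms(6) by (simp add: C)
  show ?thesis
  proof (cases "real p powr (real r / 4 - 1) / 2 powr (1 / 4) \<le> real (card F)")
    case False
    \<comment> \<open>With few exceptional places \<open>m\<close> is prime to \<open>p\<close>, as
      Euler's theorem requires.\<close>
    have "\<not> p dvd n"
    proof
      assume "p dvd n"
      from card_non_exponential_ge[OF \<open>prime p\<close> \<open>r \<ge> 1\<close> this bij[unfolded N_def]]
      have "p ^ r \<le> 2 * card F" by (simp add: F_def N_def)
      then have "real (p ^ r) \<le> real (2 * card F)" by (simp only: of_nat_le_iff)
      then have "real p ^ r / 2 \<le> real (card F)" by simp
      with powr_quarter_le_half_power[OF \<open>p \<ge> 2\<close>, of r] False show False by linarith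
    qed
    then have "coprime n p"
      using \<open>prime p\<close> by (metis coprime_commute prime_imp_coprime)
    \<comment> \<open>Arcs need a starting place; the hypothesis on \<open>m - 1\<close> provides
      one.\<close>
    moreover have "F \<noteq> {}"
      using ex_non_exponential[OF \<open>prime p\<close> \<open>r \<ge> 1\<close>, of n f] assms(4) bij
      by (auto simp: F_def N_def m)
    ultimately have "card G \<le> (card F * (p - 1)) ^ 4"
      using card_four_cycles_le[OF \<open>prime p\<close>, of n f r F] bij
      by (simp add: F_def G_def N_def bij_betw_def)
    then have "real (card G) \<le> real (card F * (p - 1)) ^ 4"
      by (simp only: of_nat_power[symmetric] of_nat_le_iff)
    with power4_less_of_less_powr_quarter[OF \<open>p \<ge> 2\<close>, of "card F" r] False
    have "2 * real (card G) \<le> real p ^ r" by simp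
    \<comment> \<open>At most half of the residues are fixed by the fourth iterate, so at least half
      are moved.\<close>
    moreover have "card {0..<N} = card G + card {x \<in> {0..<N}. f (f (f (f x))) \<noteq> x}"
      unfolding G_def by (rule card_eq_card_filter_add_card_filter_not) simp
    then have "real p ^ r = real (card G) + real (card {x \<in> {0..<N}. f (f (f (f x))) \<noteq> x})"
      by (simp add: N_def nat_power_eq flip: of_nat_add of_nat_power)
    ultimately show ?thesis by (simp add: C)
  qed (simp add: F)
qed

end
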